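(* Let $h=(h_0,\dots,h_m)\in H(A_m)$, i.e. $h=\sum_{k=0}^m h_kT_{a(m,k)}$ with $h_k\in H(A_{m-1})$, and let $j,l$ be integers with $1\le j\le m$ and $0\le l\le j$. Then $$(h_0,\dots,h_m)\,T_{a(j,l)}=(h_0',\dots,h_m'),$$ where, for $0\le k\le m$, (a) $h_k'=h_kT_{a(j,l)}$ if $k<m-j$; (b) $h_k'=q\,h_{k+1}T_{a(j-1,l-1)}$ if $m-j\le k<m-j+l$; (c) $h_k'=h_{m-j}+(q-1)\sum_{i=1}^{l}h_{m-j+i}T_{a(j-1,i-1)}$ if $k=m-j+l$; (d) $h_k'=h_kT_{a(j-1,l)}$ if $k>m-j+l$.
   Context: $m\ge1$; $Z$ is a commutative ring with one and $q\in Z$. $W(A_m)=\mathsf{Sym}_{m+1}$ on $\{1,\dots,m+1\}$ with generators $S=\{s_1,\dots,s_m\}$, $s_i=(i,i+1)$, permutations multiplied from left to right, and length function $\ell$; $W(A_{m-1})=\langle s_1,\dots,s_{m-1}\rangle\le W(A_m)$, $W(A_0)$ trivial. For $j\ge0$ put $a(j,0)=1$ and $a(j,k)=s_js_{j-1}\cdots s_{j-k+1}$ for $1\le k\le j$. The Iwahori–Hecke algebra $H(A_m)$ is the free $Z$-module with basis $\{T_w:w\in W(A_m)\}$ and the associative unital $Z$-algebra structure (identity $T_1$) determined by $T_wT_s=T_{ws}$ if $\ell(ws)>\ell(w)$ and $T_wT_s=(q-1)T_w+qT_{ws}$ if $\ell(ws)<\ell(w)$, for $w\in W(A_m)$, $s\in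 S$. $H(A_{m-1})$ is the subalgebra spanned by $T_w$, $w\in W(A_{m-1})$, and $H(A_0)=Z$. Every $h\in H(A_m)$ is uniquely of the form $\sum_{k=0}^m h_kT_{a(m,k)}$ with $h_k\in H(A_{m-1})$, and one writes $h=(h_0,\dots,h_m)$ (the nested coefficient list of $h$). Empty sums are $0$. *)

theory Defs
  imports "HOL-Combinatorics.Permutations" "HOL-Library.Poly_Mapping"
begin

section \<open>The symmetric group as a Coxeter group\<close>

type_synonym perm = "nat \<Rightarrow> nat"

text \<open>Permutations are multiplied from left to right: first \<open>u\<close>, then \<open>v\<close>.\<close>

definition perm_mult :: "perm \<Rightarrow> perm \<Rightarrow> perm" (infixl "\<odot>" 75)
  where "u \<odot> v = v \<circ> u"

text \<open>The group of type \<open>A\<^sub>m\<close>.  Since permutations are functions on all of \<open>nat\<close> that are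
  the identity outside the given set, \<open>W(A\<^sub>m\<^sub>-\<^sub>1)\<close> is literally a subset of \<open>W(A\<^sub>m)\<close>; it is the
  subgroup generated by \<open>s\<^sub>1, \<dots>, s\<^sub>m\<^sub>-\<^sub>1\<close>, see \<open>weyl_eq_words\<close> below.\<close>

definition weyl :: "nat \<Rightarrow> perm set"
  where "weyl m = {w. w permutes {1..m+1}}"

definition sgen :: "nat \<Rightarrow> perm"
  where "sgen i = transpose i (i + 1)"

definition word_perm :: "nat list \<Rightarrow> perm"
  where "word_perm is = foldl (\<lambda>w i. w \<odot> sgen i) id is"

definition len :: "nat \<Rightarrow> perm \<Rightarrow> nat"
  where "len m w = (LEAST n. \<exists>is. set is \<subseteq> {1..m} \<and> length is = n \<and> word_perm is = w)"

text \<open>\<open>a_elem j k = s\<^sub>j s\<^sub>j\<^sub>-\<^sub>1 \<dots> s\<^sub>j\<^sub>-\<^sub>k\<^sub>+\<^sub>1\<close>, used for \<open>k \<le> j\<close>; it is the identity for \<open>k = 0\<close>.\<close>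

definition a_elem :: "nat \<Rightarrow> nat \<Rightarrow> perm"
  where "a_elem j k = word_perm (rev [j + 1 - k..<j + 1])"


section \<open>The Iwahori--Hecke algebra\<close>

text \<open>The coefficient sort is that of commutative rings with one in which \<open>0 = 1\<close> is allowed;
  \<open>comm_ring_1\<close> would exclude the zero ring.

  The underlying free module consists of the finitely supported functions whose support lies in
  \<open>W(A\<^sub>m)\<close>.  For \<open>m \<ge> 1\<close>, the span of the basis elements indexed by \<open>W(A\<^sub>m\<^sub>-\<^sub>1)\<close> in it is
  \<open>hecke_module (m - 1)\<close>.\<close>

definition hecke_module :: "nat \<Rightarrow> (perm \<Rightarrow>\<^sub>0 'z::{comm_ring,comm_monoid_mult}) set"
  where "hecke_module m = {x. Poly_Mapping.keys x \<subseteq> weyl m}"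

definition basis_T :: "perm \<Rightarrow> (perm \<Rightarrow>\<^sub>0 'z::{comm_ring,comm_monoid_mult})"
  where "basis_T w = Poly_Mapping.single w 1"

definition scale :: "'z \<Rightarrow> (perm \<Rightarrow>\<^sub>0 'z) \<Rightarrow> (perm \<Rightarrow>\<^sub>0 'z::{comm_ring,comm_monoid_mult})"
  where "scale c x = Poly_Mapping.map (\<lambda>d. c * d) x"

text \<open>\<open>hecke_algebra m q mul\<close>: restricted to \<open>hecke_module m\<close>, the operation \<open>mul\<close> is the
  multiplication of \<open>H(A\<^sub>m)\<close> with parameter \<open>q\<close>.  Such a multiplication exists
  (\<open>hecke_algebra_exists\<close>) and is unique on \<open>hecke_module m\<close> (\<open>hecke_algebra_unique\<close>).  For
  \<open>m \<ge> 1\<close>, its restriction to \<open>hecke_module (m - 1)\<close> is the multiplication of the subalgebra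
  \<open>H(A\<^sub>m\<^sub>-\<^sub>1)\<close>.\<close>

locale hecke_algebra =
  fixes m :: nat
    and q :: "'z::{comm_ring,comm_monoid_mult}"
    and mul :: "(perm \<Rightarrow>\<^sub>0 'z) \<Rightarrow> (perm \<Rightarrow>\<^sub>0 'z) \<Rightarrow> (perm \<Rightarrow>\<^sub>0 'z)" (infixl "\<cdot>" 70)
  assumes closed: "\<lbrakk>x \<in> hecke_module m; y \<in> hecke_module m\<rbrakk> \<Longrightarrow> x \<cdot> y \<in> hecke_module m"
    and add_left: "\<lbrakk>x \<in> hecke_module m; y \<in> hecke_module m; z \<in> hecke_module m\<rbrakk>
      \<Longrightarrow> (x + y) \<cdot> z = x \<cdot> z + y \<cdot> z"
    and add_right: "\<lbrakk>x \<in> hecke_module m; y \<in> hecke_module m; z \<in> hecke_module m\<rbrakk>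
      \<Longrightarrow> x \<cdot> (y + z) = x \<cdot> y + x \<cdot> z"
    and scale_left: "\<lbrakk>x \<in> hecke_module m; y \<in> hecke_module m\<rbrakk>
      \<Longrightarrow> scale c x \<cdot> y = scale c (x \<cdot> y)"
    and scale_right: "\<lbrakk>x \<in> hecke_module m; y \<in> hecke_module m\<rbrakk>
      \<Longrightarrow> x \<cdot> scale c y = scale c (x \<cdot> y)"
    and assoc: "\<lbrakk>x \<in> hecke_module m; y \<in> hecke_module m; z \<in> hecke_module m\<rbrakk>
      \<Longrightarrow> (x \<cdot> y) \<cdot> z = x \<cdot> (y \<cdot> z)"
    and one_left: "x \<in> hecke_module m \<Longrightarrow> basis_T id \<cdot> x = x"
    and one_right: "x \<in> hecke_module m \<Longrightarrow> x \<cdot> basis_T id = x"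
    and T_up: "\<lbrakk>w \<in> weyl m; i \<in> {1..m}; len m (w \<odot> sgen i) > len m w\<rbrakk>
      \<Longrightarrow> basis_T w \<cdot> basis_T (sgen i) = basis_T (w \<odot> sgen i)"
    and T_down: "\<lbrakk>w \<in> weyl m; i \<in> {1..m}; len m (w \<odot> sgen i) < len m w\<rbrakk>
      \<Longrightarrow> basis_T w \<cdot> basis_T (sgen i)
        = scale (q - 1) (basis_T w) + scale q (basis_T (w \<odot> sgen i))"

text \<open>The element \<open>(h\<^sub>0, \<dots>, h\<^sub>m) = \<Sum>\<^sub>k h\<^sub>k T\<^bsub>a(m,k)\<^esub>\<close> with nested coefficient list \<open>h\<close>.\<close>

definition nested :: "nat \<Rightarrow> ((perm \<Rightarrow>\<^sub>0 'z) \<Rightarrow> (perm \<Rightarrow>\<^sub>0 'z) \<Rightarrow> (perm \<Rightarrow>\<^sub>0 'z))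
    \<Rightarrow> (nat \<Rightarrow> (perm \<Rightarrow>\<^sub>0 'z)) \<Rightarrow> (perm \<Rightarrow>\<^sub>0 'z::{comm_ring,comm_monoid_mult})"
  where "nested m mul h = (\<Sum>k = 0..m. mul (h k) (basis_T (a_elem m k)))"


section \<open>Inversions and length\<close>

lemma sgen_simps [simp]: "sgen i i = i + 1" "sgen i (Suc i) = i" "sgen i (sgen i x) = x"
  "inv (sgen i) = sgen i" "sgen i \<circ> sgen i = id" "bij (sgen i)"
  by (auto simp: sgen_def fun_eq_iff)

lemma sgen_app: "sgen i x = (if x = i then i + 1 else if x = i + 1 then i else x)"
  by (auto simp: sgen_def transpose_def)

lemma sgen_less: "x \<noteq> y \<Longrightarrow> {x, y} \<noteq> {i, i + 1} \<Longrightarrow> sgen i x < sgen i y \<longleftrightarrow> x < y"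
  by (auto simp: sgen_app doubleton_eq_iff)

lemma sgen_weyl [simp]: "1 \<le> i \<Longrightarrow> i \<le> m \<Longrightarrow> sgen i \<in> weyl m"
  unfolding weyl_def sgen_def using permutes_swap_id[of i "{1..m+1}" "i+1"] by simp

lemma weyl_bij: "w \<in> weyl m \<Longrightarrow> bij w"
  unfolding weyl_def by (auto intro: permutes_bij)

lemma weyl_id [simp]: "id \<in> weyl m"
  by (simp add: weyl_def permutes_id)

lemma weyl_comp [simp]: "u \<in> weyl m \<Longrightarrow> v \<in> weyl m \<Longrightarrow> u \<circ> v \<in> weyl m"
  by (simp add: weyl_def permutes_compose)

lemma weyl_inv [simp]: "w \<in> weyl m \<Longrightarrow> inv w \<in> weyl m"
  by (simp add: weyl_def permutes_inv)

definition invs :: "perm \<Rightarrow> nat \<Rightarrow> (nat \<times> nat) set"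
  where "invs w m = {(a, b). a \<in> {1..m+1} \<and> b \<in> {1..m+1} \<and> a < b \<and> w b < w a}"

lemma finite_invs [simp]: "finite (invs w m)"
  by (rule finite_subset[of _ "{1..m+1} \<times> {1..m+1}"]) (auto simp: invs_def)

text \<open>\<open>up j w\<close> is the condition for \<open>\<ell>(w s\<^sub>j) > \<ell>(w)\<close>.\<close>

definition up :: "nat \<Rightarrow> perm \<Rightarrow> bool"
  where "up j w \<longleftrightarrow> inv w j < inv w (j + 1)"

lemma inv_sgen_comp: "bij w \<Longrightarrow> inv (sgen j \<circ> w) = inv w \<circ> sgen j"
  by (simp add: o_inv_distrib)

lemma up_sgen: assumes "bij w" shows "up j (sgen j \<circ> w) \<longleftrightarrow> \<not> up j w"
proof -
  have "inv w j \<noteq> inv w (j+1)"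
    using assms by (metis bij_inv_eq_iff n_not_Suc_n Suc_eq_plus1)
  then show ?thesis using assms by (auto simp: up_def inv_sgen_comp)
qed

lemma card_invs_up:
  assumes w: "w \<in> weyl m" and j: "j \<in> {1..m}" and u: "up j w"
  shows "card (invs (sgen j \<circ> w) m) = Suc (card (invs w m))"
proof -
  let ?p = "inv w j" and ?r = "inv w (j + 1)"
  have b: "bij w" using w by (rule weyl_bij)
  have wp: "w ?p = j" "w ?r = j + 1" using b by (simp_all add: bij_is_surj surj_f_inv_f)
  have pe: "w x = j \<longleftrightarrow> x = ?p" "w x = j + 1 \<longleftrightarrow> x = ?r" for x
    using b wp by (metis bij_inv_eq_iff)+
  have "inv w permutes {1..m+1}" using w by (simp add: weyl_def permutes_inv)
  then have pin: "?p \<in> {1..m+1}" "?r \<in> {1..m+1}"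
    using j permutes_in_image[of "inv w" "{1..m+1}"] by auto
  have lt: "?p < ?r" using u by (simp add: up_def)
  have "invs (sgen j \<circ> w) m = insert (?p, ?r) (invs w m)"
  proof (rule set_eqI, clarify)
    fix x y
    show "(x, y) \<in> invs (sgen j \<circ> w) m \<longleftrightarrow> (x, y) \<in> insert (?p, ?r) (invs w m)"
    proof (cases "{w x, w y} = {j, j+1} \<or> \<not> x < y")
      case True
      then consider "\<not> x < y" | "x = ?p" "y = ?r" | "x = ?r" "y = ?p"
        using pe[of x] pe[of y] by (auto simp: doubleton_eq_iff)
      then show ?thesis
      proof cases
        case 1
        then show ?thesis using lt by (auto simp: invs_def)
      next
        case 2
        then show ?thesis using lt pin wp by (simp add: invs_def)
      next
        case 3
        then show ?thesis using lt by (auto simp: invs_def)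
      qed
    next
      case False
      then have ne: "w x \<noteq> w y" using b by (metis bij_is_inj injD less_irrefl)
      have "sgen j (w y) < sgen j (w x) \<longleftrightarrow> w y < w x"
        using sgen_less[of "w y" "w x" j] ne False by (auto simp: insert_commute)
      moreover have "(x, y) \<noteq> (?p, ?r)" using False wp by auto
      ultimately show ?thesis by (auto simp: invs_def)
    qed
  qed
  moreover have "(?p, ?r) \<notin> invs w m" using wp by (simp add: invs_def)
  ultimately show ?thesis by simp
qed

lemma card_invs_down:
  assumes w: "w \<in> weyl m" and j: "j \<in> {1..m}" and u: "\<not> up j w"
  shows "card (invs w m) = Suc (card (invs (sgen j \<circ> w) m))"
proof -
  have "sgen j \<circ> (sgen j \<circ> w) = w" by (simp add: fun_eq_iff)
  then show ?thesis
    using card_invs_up[of "sgen j \<circ> w" m j] w j u up_sgen[OF weyl_bij[OF w]] by simp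
qed

lemma exists_down:
  assumes w: "w \<in> weyl m" and all: "\<forall>j\<in>{1..m}. up j w" shows "w = id"
proof -
  let ?u = "inv w"
  have p: "?u permutes {1..m+1}" using w by (simp add: weyl_def permutes_inv)
  have ge: "x \<le> ?u x" if "1 \<le> x" "x \<le> m + 1" for x
    using that
  proof (induction x rule: nat_induct_at_least)
    case base
    have "?u 1 \<in> {1..m+1}" using permutes_in_image[OF p, of 1] by simp
    then show ?case by simp
  next
    case (Suc x)
    then have "up x w" using all by simp
    then show ?case using Suc by (simp add: up_def)
  qed
  have "?u = id" by (rule permutes_natset_ge[OF p]) (use ge in auto)
  then show ?thesis using w by (metis inv_id inv_inv_eq weyl_bij)
qed

lemma weyl_induct [consumes 1, case_names id step]:
  assumes w: "w \<in> weyl m" and 0: "P id"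
    and step: "\<And>w j. \<lbrakk>w \<in> weyl m; j \<in> {1..m}; up j w; P w\<rbrakk> \<Longrightarrow> P (sgen j \<circ> w)"
  shows "P w"
  using w
proof (induction "card (invs w m)" arbitrary: w rule: less_induct)
  case less
  show ?case
  proof (cases "w = id")
    case False
    then obtain j where j: "j \<in> {1..m}" "\<not> up j w" using exists_down less.prems by blast
    let ?v = "sgen j \<circ> w"
    have v: "?v \<in> weyl m" using j less.prems by simp
    have "P ?v" using card_invs_down[OF less.prems j] v less.hyps by simp
    moreover have "up j ?v" using up_sgen weyl_bij less.prems j by blast
    ultimately have "P (sgen j \<circ> ?v)" using step v j by blast
    moreover have "sgen j \<circ> ?v = w" by (simp add: fun_eq_iff)
    ultimately show ?thesis by simp
  qed (simp add: 0)
qed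

text \<open>The same with multiplication from the other side.\<close>

lemma weyl_induct_left [consumes 1, case_names id step]:
  assumes w: "w \<in> weyl m" and 0: "P id"
    and step: "\<And>w j. \<lbrakk>w \<in> weyl m; j \<in> {1..m}; w j < w (j + 1); P w\<rbrakk> \<Longrightarrow> P (w \<circ> sgen j)"
  shows "P w"
proof -
  have "P (inv v)" if "v \<in> weyl m" for v
    using that
  proof (induction v rule: weyl_induct)
    case (step w j)
    then have "P (inv w \<circ> sgen j)" using assms(3)[of "inv w" j] by (simp add: up_def)
    then show ?case using inv_sgen_comp[OF weyl_bij[OF step(1)]] by (simp del: o_apply id_apply)
  qed (use 0 in \<open>simp add: inv_id del: o_apply id_apply\<close>)
  from this[of "inv w"] show ?thesis using w by (simp add: inv_inv_eq weyl_bij)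
qed

lemma word_perm_simps [simp]: "word_perm [] = id"
  "word_perm (is @ [i]) = sgen i \<circ> word_perm is"
  by (simp_all add: word_perm_def perm_mult_def)

lemma word_perm_weyl: "set is \<subseteq> {1..m} \<Longrightarrow> word_perm is \<in> weyl m"
  by (induction "is" rule: rev_induct) auto

lemma reduced_word_exists:
  "w \<in> weyl m \<Longrightarrow> \<exists>is. set is \<subseteq> {1..m} \<and> length is = card (invs w m) \<and> word_perm is = w"
proof (induction w rule: weyl_induct)
  case id
  have "invs id m = {}" by (auto simp: invs_def)
  then show ?case by (simp del: o_apply id_apply)
next
  case (step w j)
  then obtain "is" where i: "set is \<subseteq> {1..m}" "length is = card (invs w m)" "word_perm is = w"
    by blast
  show ?case
    by (rule exI[of _ "is @ [j]"]) (use i step card_invs_up in \<open>simp del: o_apply id_apply\<close>)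
qed

theorem weyl_eq_words: "weyl m = word_perm ` {is. set is \<subseteq> {1..m}}"
  using reduced_word_exists word_perm_weyl by (fastforce simp: image_iff)

lemma card_invs_le_length: "set is \<subseteq> {1..m} \<Longrightarrow> card (invs (word_perm is) m) \<le> length is"
proof (induction "is" rule: rev_induct)
  case Nil
  have "invs id m = {}" by (auto simp: invs_def)
  then show ?case by (simp del: o_apply id_apply)
next
  case (snoc i "is")
  then have "word_perm is \<in> weyl m" by (simp add: word_perm_weyl)
  then show ?case
    using snoc card_invs_up[of "word_perm is" m i] card_invs_down[of "word_perm is" m i]
    by (cases "up i (word_perm is)") (auto simp del: o_apply id_apply)
qed

lemma len_eq_card_invs: "w \<in> weyl m \<Longrightarrow> len m w = card (invs w m)"
  unfolding len_def
  by (rule Least_equality) (use reduced_word_exists card_invs_le_length in auto)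

lemma len_less_iff_up:
  assumes "w \<in> weyl m" "j \<in> {1..m}"
  shows "len m w < len m (w \<odot> sgen j) \<longleftrightarrow> up j w" "len m (w \<odot> sgen j) < len m w \<longleftrightarrow> \<not> up j w"
proof -
  have "w \<odot> sgen j \<in> weyl m" using assms by (simp add: perm_mult_def)
  then show "len m w < len m (w \<odot> sgen j) \<longleftrightarrow> up j w" "len m (w \<odot> sgen j) < len m w \<longleftrightarrow> \<not> up j w"
    using assms card_invs_up[OF assms] card_invs_down[OF assms]
    by (cases "up j w"; simp add: len_eq_card_invs perm_mult_def)+
qed


section \<open>Existence and uniqueness of the Hecke algebra\<close>

lemma lookup_scale [simp]: "Poly_Mapping.lookup (scale c x) w = c * Poly_Mapping.lookup x w"
  by (simp add: scale_def Poly_Mapping.map.rep_eq when_def)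

lemma scale_simps:
  "scale c (x + y) = scale c x + scale c y" "scale (c + d) x = scale c x + scale d x"
  "scale (c - d) x = scale c x - scale d x"
  "scale c (x - y) = scale c x - scale c y"
  "scale c (scale d x) = scale (c * d) x" "scale 1 x = x" "scale 0 x = 0" "scale c 0 = 0"
  by (rule poly_mapping_eqI, simp add: lookup_add lookup_minus algebra_simps)+

lemma scale_sum: "scale c (sum f A) = (\<Sum>a\<in>A. scale c (f a))"
  by (induction A rule: infinite_finite_induct) (simp_all add: scale_simps)

lemma hecke_module_add [simp]:
  "x \<in> hecke_module m \<Longrightarrow> y \<in> hecke_module m \<Longrightarrow> x + y \<in> hecke_module m"
  unfolding hecke_module_def using keys_add[of x y] by blast

lemma hecke_module_scale [simp]: "x \<in> hecke_module m \<Longrightarrow> scale c x \<in> hecke_module m"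
  unfolding hecke_module_def by (metis (mono_tags, lifting) in_keys_iff lookup_scale mem_Collect_eq mult_zero_right subset_iff)

lemma hecke_module_0 [simp]: "0 \<in> hecke_module m"
  unfolding hecke_module_def by simp

lemma hecke_module_T [simp]: "w \<in> weyl m \<Longrightarrow> basis_T w \<in> hecke_module m"
  unfolding hecke_module_def basis_T_def by simp

lemma hecke_module_sum: "(\<And>a. a \<in> A \<Longrightarrow> f a \<in> hecke_module m) \<Longrightarrow> sum f A \<in> hecke_module m"
  by (induction A rule: infinite_finite_induct) simp_all

lemma basis_expand: "x = (\<Sum>w\<in>Poly_Mapping.keys x. scale (Poly_Mapping.lookup x w) (basis_T w))"
proof (rule poly_mapping_eqI)
  fix v
  have "Poly_Mapping.lookup (\<Sum>w\<in>Poly_Mapping.keys x. scale (Poly_Mapping.lookup x w) (basis_T w)) v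
      = (\<Sum>w\<in>Poly_Mapping.keys x. if v = w then Poly_Mapping.lookup x w else 0)"
    unfolding lookup_sum by (rule sum.cong) (auto simp: basis_T_def lookup_single when_def)
  then show "Poly_Mapping.lookup x v = Poly_Mapping.lookup (\<Sum>w\<in>Poly_Mapping.keys x. scale (Poly_Mapping.lookup x w) (basis_T w)) v"
    by (simp add: in_keys_iff)
qed

lemma hecke_module_induct [consumes 1, case_names zero add]:
  assumes x: "x \<in> hecke_module m" and 0: "P 0"
    and add: "\<And>x c w. \<lbrakk>x \<in> hecke_module m; w \<in> weyl m; P x\<rbrakk> \<Longrightarrow> P (scale c (basis_T w) + x)"
  shows "P x"
proof -
  have "(\<Sum>w\<in>A. scale (f w) (basis_T w)) \<in> hecke_module m \<and> P (\<Sum>w\<in>A. scale (f w) (basis_T w))"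
    if "finite A" "A \<subseteq> weyl m" for A f
    using that by (induction A) (auto simp: 0 intro!: add)
  from this[of "Poly_Mapping.keys x" "Poly_Mapping.lookup x"] show ?thesis
    using x basis_expand[of x] by (simp add: hecke_module_def)
qed

text \<open>Linear extension of a map defined on the basis.\<close>

definition extend :: "(perm \<Rightarrow> (perm \<Rightarrow>\<^sub>0 'z)) \<Rightarrow> (perm \<Rightarrow>\<^sub>0 'z)
    \<Rightarrow> (perm \<Rightarrow>\<^sub>0 'z::{comm_ring,comm_monoid_mult})"
  where "extend f x = (\<Sum>w\<in>Poly_Mapping.keys x. scale (Poly_Mapping.lookup x w) (f w))"

lemma extend_superset:
  "finite A \<Longrightarrow> Poly_Mapping.keys x \<subseteq> A \<Longrightarrow> extend f x = (\<Sum>w\<in>A. scale (Poly_Mapping.lookup x w) (f w))"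
  unfolding extend_def by (rule sum.mono_neutral_left) (auto simp: in_keys_iff scale_simps)

lemma extend_simps [simp]:
  "extend f (x + y) = extend f x + extend f y"
  "extend f (scale c x) = scale c (extend f x)"
  "extend f (basis_T w) = f w"
  "extend f 0 = 0"
proof -
  have "Poly_Mapping.keys (x + y) \<subseteq> Poly_Mapping.keys x \<union> Poly_Mapping.keys y" by (rule keys_add)
  then show "extend f (x + y) = extend f x + extend f y"
    using extend_superset[of "Poly_Mapping.keys x \<union> Poly_Mapping.keys y" x f] extend_superset[of "Poly_Mapping.keys x \<union> Poly_Mapping.keys y" y f]
      extend_superset[of "Poly_Mapping.keys x \<union> Poly_Mapping.keys y" "x + y" f]
    by (simp add: lookup_add scale_simps sum.distrib)
  have "Poly_Mapping.keys (scale c x) \<subseteq> Poly_Mapping.keys x" by (auto simp: in_keys_iff)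
  then show "extend f (scale c x) = scale c (extend f x)"
    using extend_superset[of "Poly_Mapping.keys x" "scale c x" f]
    by (simp add: extend_def[of f x] scale_sum scale_simps)
  show "extend f (basis_T w) = f w"
    using extend_superset[of "{w}" "basis_T w" f]
    by (simp add: basis_T_def scale_simps)
  show "extend f 0 = 0" by (simp add: extend_def)
qed

lemma extend_closed:
  assumes "x \<in> hecke_module m" "\<And>w. w \<in> weyl m \<Longrightarrow> f w \<in> hecke_module m"
  shows "extend f x \<in> hecke_module m"
  using assms(1) by (induction rule: hecke_module_induct) (simp_all add: assms(2))

text \<open>Right and left multiplication by \<open>T\<^bsub>s\<^esub>\<close>.\<close>

definition rmul :: "'z \<Rightarrow> nat \<Rightarrow> (perm \<Rightarrow>\<^sub>0 'z) \<Rightarrow> (perm \<Rightarrow>\<^sub>0 'z::{comm_ring,comm_monoid_mult})"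
  where "rmul q j = extend (\<lambda>w. if up j w then basis_T (sgen j \<circ> w)
    else scale (q - 1) (basis_T w) + scale q (basis_T (sgen j \<circ> w)))"

definition lmul :: "'z \<Rightarrow> nat \<Rightarrow> (perm \<Rightarrow>\<^sub>0 'z) \<Rightarrow> (perm \<Rightarrow>\<^sub>0 'z::{comm_ring,comm_monoid_mult})"
  where "lmul q i = extend (\<lambda>w. if w i < w (i + 1) then basis_T (w \<circ> sgen i)
    else scale (q - 1) (basis_T w) + scale q (basis_T (w \<circ> sgen i)))"

lemma mul_simps [simp]:
  "rmul q j (x + y) = rmul q j x + rmul q j y" "rmul q j (scale c x) = scale c (rmul q j x)"
  "rmul q j 0 = 0"
  "lmul q j (x + y) = lmul q j x + lmul q j y" "lmul q j (scale c x) = scale c (lmul q j x)"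
  "lmul q j 0 = 0"
  by (simp_all add: rmul_def lmul_def)

lemma rmul_T: "rmul q j (basis_T w) = (if up j w then basis_T (sgen j \<circ> w)
    else scale (q - 1) (basis_T w) + scale q (basis_T (sgen j \<circ> w)))"
  by (simp add: rmul_def)

lemma lmul_T: "lmul q i (basis_T w) = (if w i < w (i + 1) then basis_T (w \<circ> sgen i)
    else scale (q - 1) (basis_T w) + scale q (basis_T (w \<circ> sgen i)))"
  by (simp add: lmul_def)

lemma rmul_closed: "x \<in> hecke_module m \<Longrightarrow> j \<in> {1..m} \<Longrightarrow> rmul q j x \<in> hecke_module m"
  unfolding rmul_def by (rule extend_closed) auto

lemma lmul_closed: "x \<in> hecke_module m \<Longrightarrow> j \<in> {1..m} \<Longrightarrow> lmul q j x \<in> hecke_module m"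
  unfolding lmul_def by (rule extend_closed) auto

lemma lmul_rmul_T:
  assumes b: "bij w"
  shows "lmul q i (rmul q j (basis_T w)) = rmul q j (lmul q i (basis_T w))"
proof (cases "{w i, w (i + 1)} = {j, j + 1}")
  case True
  have bi: "inv w y = x \<longleftrightarrow> w x = y" for x y using b bij_inv_eq_iff by metis
  have w_inj: "w x = w y \<longleftrightarrow> x = y" for x y using b by (metis bij_is_inj injD)
  have c: "sgen j \<circ> w = w \<circ> sgen i"
  proof
    fix x
    consider "x = i" | "x = i + 1" | "x \<noteq> i" "x \<noteq> i + 1" by blast
    then show "(sgen j \<circ> w) x = (w \<circ> sgen i) x"
    proof cases
      case 3
      then have "w x \<notin> {w i, w (i + 1)}" using w_inj by simp
      then show ?thesis using 3 unfolding True by (simp add: sgen_app)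
    qed (use True in \<open>auto simp: doubleton_eq_iff\<close>)
  qed
  have u: "up j w \<longleftrightarrow> w i < w (i + 1)"
  proof -
    consider "inv w j = i" "inv w (j+1) = i + 1" "w i = j" "w (i + 1) = j + 1"
      | "inv w j = i + 1" "inv w (j+1) = i" "w i = j + 1" "w (i + 1) = j"
      using True by (auto simp: doubleton_eq_iff bi)
    then show ?thesis by cases (simp_all add: up_def)
  qed
  have eq: "lmul q i (basis_T w) = rmul q j (basis_T w)"
    using u by (simp add: lmul_T rmul_T c)
  have u': "up j (w \<circ> sgen i) \<longleftrightarrow> \<not> up j w" using up_sgen[OF b] c by metis
  have u'': "(w \<circ> sgen i) i < (w \<circ> sgen i) (i + 1) \<longleftrightarrow> \<not> up j w"
    using u w_inj[of i "i + 1"] by auto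
  have "sgen j \<circ> (w \<circ> sgen i) = w" unfolding c[symmetric] by (simp add: fun_eq_iff)
  moreover have "w \<circ> sgen i \<circ> sgen i = w" by (simp add: fun_eq_iff)
  ultimately have eq': "lmul q i (basis_T (w \<circ> sgen i)) = rmul q j (basis_T (w \<circ> sgen i))"
    unfolding lmul_T rmul_T using u' u'' by simp
  show ?thesis unfolding eq unfolding rmul_T c using eq eq' by (simp add: rmul_T c)
next
  case False
  have bi: "inv w y = x \<longleftrightarrow> w x = y" for x y using b bij_inv_eq_iff by metis
  have w_inj: "w x = w y \<longleftrightarrow> x = y" for x y using b by (metis bij_is_inj injD)
  have 1: "(sgen j \<circ> w) i < (sgen j \<circ> w) (i + 1) \<longleftrightarrow> w i < w (i + 1)"
    using sgen_less[of "w i" "w (i + 1)" j] False w_inj by simp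
  have ii: "inv w x = inv w y \<longleftrightarrow> x = y" for x y
    using b by (metis bij_inv_eq_iff)
  have "{inv w j, inv w (j + 1)} \<noteq> {i, i + 1}"
    using False by (auto simp: doubleton_eq_iff bi)
  moreover have "inv (w \<circ> sgen i) = sgen i \<circ> inv w" using b by (simp add: o_inv_distrib)
  ultimately have 2: "up j (w \<circ> sgen i) \<longleftrightarrow> up j w"
    using sgen_less[of "inv w j" "inv w (j + 1)" i] ii by (simp add: up_def)
  have 3: "sgen j \<circ> w \<circ> sgen i = sgen j \<circ> (w \<circ> sgen i)" by (simp add: o_assoc)
  show ?thesis
    using 1 2 by (auto simp: rmul_T lmul_T 3 scale_simps(1,5) mult.commute add_ac simp del: o_apply)
qed

lemma lmul_rmul:
  assumes "x \<in> hecke_module m"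
  shows "lmul q i (rmul q j x) = rmul q j (lmul q i x)"
  using assms
  by (induction rule: hecke_module_induct) (simp_all add: lmul_rmul_T weyl_bij)

definition lword :: "'z \<Rightarrow> nat list \<Rightarrow> (perm \<Rightarrow>\<^sub>0 'z) \<Rightarrow> (perm \<Rightarrow>\<^sub>0 'z::{comm_ring,comm_monoid_mult})"
  where "lword q is x = foldr (lmul q) is x"

lemma lword_simps [simp]:
  "lword q [] x = x"
  "lword q (i # is) x = lmul q i (lword q is x)"
  "lword q is (x + y) = lword q is x + lword q is y"
  "lword q is (scale c x) = scale c (lword q is x)"
  "lword q is 0 = 0"
  by (induction "is") (simp_all add: lword_def)

lemma lword_closed:
  "set is \<subseteq> {1..m} \<Longrightarrow> x \<in> hecke_module m \<Longrightarrow> lword q is x \<in> hecke_module m"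
  by (induction "is") (simp_all add: lmul_closed)

lemma lword_rmul:
  "set is \<subseteq> {1..m} \<Longrightarrow> x \<in> hecke_module m \<Longrightarrow> lword q is (rmul q j x) = rmul q j (lword q is x)"
  by (induction "is") (simp_all add: lmul_rmul[of _ m] lword_closed)

lemma lword_exists:
  "w \<in> weyl m \<Longrightarrow> \<exists>is. set is \<subseteq> {1..m} \<and> lword q is (basis_T id) = basis_T w"
proof (induction w rule: weyl_induct_left)
  case id
  show ?case by (rule exI[of _ "[]"]) simp
next
  case (step w j)
  then obtain "is" where "set is \<subseteq> {1..m}" "lword q is (basis_T id) = basis_T w" by blast
  then show ?case using step by (intro exI[of _ "j # is"]) (simp add: lmul_T del: o_apply id_apply)
qed

theorem hecke_algebra_exists: "\<exists>mul. hecke_algebra m (q :: 'z::{comm_ring,comm_monoid_mult}) mul"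
proof -
  obtain W where W: "\<And>w. w \<in> weyl m \<Longrightarrow> set (W w) \<subseteq> {1..m}"
      "\<And>w. w \<in> weyl m \<Longrightarrow> lword q (W w) (basis_T id) = basis_T w"
    using lword_exists[of _ m q] by metis
  have W0: "lword q (W id) x = x" if "x \<in> hecke_module m" for x
    using that
  proof (induction rule: hecke_module_induct)
    case (add x c w)
    have "lword q (W id) (basis_T w) = basis_T w" using add(2)
    proof (induction w rule: weyl_induct)
      case (step w j)
      have "basis_T (sgen j \<circ> w) = rmul q j (basis_T w)" using step by (simp add: rmul_T)
      then show ?case using step lword_rmul[OF W(1)[OF weyl_id], of "basis_T w" q j] by (simp del: o_apply id_apply)
    qed (simp add: W del: o_apply id_apply)
    then show ?case using add by (simp del: id_apply o_apply)
  qed simp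
  define mul where "mul x y = extend (\<lambda>w. lword q (W w) y) x" for x y
  have closed: "mul x y \<in> hecke_module m" if "x \<in> hecke_module m" "y \<in> hecke_module m" for x y
    unfolding mul_def by (rule extend_closed) (use that W in \<open>auto simp: lword_closed\<close>)
  have add_right: "mul x (y + z) = mul x y + mul x z" for x y z
    by (simp add: mul_def extend_def scale_simps sum.distrib)
  have scale_right: "mul x (scale c y) = scale c (mul x y)" for x y c
    by (simp add: mul_def extend_def scale_simps scale_sum mult.commute)
  have zero_right: "mul x 0 = 0" for x
    by (simp add: mul_def extend_def scale_simps)
  have add_left: "mul (x + y) z = mul x z + mul y z" for x y z
    by (simp add: mul_def)
  have scale_left: "mul (scale c x) y = scale c (mul x y)" for x y c
    by (simp add: mul_def)
  have zero_left: "mul 0 x = 0" for x by (simp add: mul_def)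
  have one_left: "mul (basis_T id) x = x" if "x \<in> hecke_module m" for x
    using that by (simp add: mul_def W0)
  have one_right: "mul x (basis_T id) = x" if "x \<in> hecke_module m" for x
    using that
    by (induction rule: hecke_module_induct) (simp_all add: mul_def W del: id_apply o_apply)
  have mul_rmul: "mul x (rmul q j y) = rmul q j (mul x y)"
    if "x \<in> hecke_module m" "y \<in> hecke_module m" for x y j
    using that(1)
    by (induction rule: hecke_module_induct) (use that in \<open>simp_all add: mul_def W lword_rmul[OF W(1)]\<close>)
  have mul_s: "mul x (basis_T (sgen j)) = rmul q j x" if "x \<in> hecke_module m" for x j
  proof -
    have "basis_T (sgen j) = rmul q j (basis_T id)" by (simp add: rmul_T up_def inv_id)
    then show ?thesis using that by (simp add: mul_rmul one_right)
  qed
  have assoc: "mul (mul x y) z = mul x (mul y z)"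
    if x: "x \<in> hecke_module m" and y: "y \<in> hecke_module m" and "z \<in> hecke_module m" for x y z
    using that(3)
  proof (induction rule: hecke_module_induct)
    case (add z c w)
    have "mul (mul x y) (basis_T w) = mul x (mul y (basis_T w))" using add(2)
    proof (induction w rule: weyl_induct)
      case (step w j)
      have "basis_T (sgen j \<circ> w) = rmul q j (basis_T w)" using step by (simp add: rmul_T)
      then show ?case using step x y by (simp add: mul_rmul closed del: o_apply id_apply)
    qed (simp add: one_right x y closed del: o_apply id_apply)
    then show ?case using add by (simp add: add_right scale_right)
  qed (simp add: zero_right)
  have "hecke_algebra m q mul"
  proof
    fix w i assume w: "w \<in> weyl m" "i \<in> {1..m}"
    show "mul (basis_T w) (basis_T (sgen i)) = basis_T (w \<odot> sgen i)"
      if "len m (w \<odot> sgen i) > len m w"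
      using that w by (simp add: len_less_iff_up mul_s rmul_T) (simp add: perm_mult_def)
    show "mul (basis_T w) (basis_T (sgen i))
        = scale (q - 1) (basis_T w) + scale q (basis_T (w \<odot> sgen i))"
      if "len m (w \<odot> sgen i) < len m w"
      using that w by (simp add: len_less_iff_up mul_s rmul_T) (simp add: perm_mult_def)
  qed (simp_all add: closed add_left add_right scale_left scale_right assoc one_left one_right)
  then show ?thesis by blast
qed

context hecke_algebra
begin

lemma zero_left: assumes "x \<in> hecke_module m" shows "0 \<cdot> x = 0"
  using scale_left[of 0 x 0] assms by (simp add: scale_simps)

lemma zero_right: assumes "x \<in> hecke_module m" shows "x \<cdot> 0 = 0"
  using scale_right[of x 0 0] assms by (simp add: scale_simps)

lemma mul_sgen:
  assumes "x \<in> hecke_module m" and j: "j \<in> {1..m}"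
  shows "x \<cdot> basis_T (sgen j) = rmul q j x"
  using assms(1)
proof (induction rule: hecke_module_induct)
  case (add x c w)
  have "basis_T w \<cdot> basis_T (sgen j) = rmul q j (basis_T w)"
    using T_up[OF add(2) j] T_down[OF add(2) j] len_less_iff_up[OF add(2) j]
    by (auto simp: rmul_T perm_mult_def)
  then show ?case using add j by (simp add: add_left scale_left)
qed (use j in \<open>simp add: zero_left\<close>)

end

theorem hecke_algebra_unique:
  assumes "hecke_algebra m q mul" "hecke_algebra m q mul'"
    and x: "x \<in> hecke_module m" and y: "y \<in> hecke_module m"
  shows "mul x y = mul' x y"
proof -
  interpret A: hecke_algebra m q mul by fact
  interpret B: hecke_algebra m q mul' by fact
  show ?thesis using y
  proof (induction rule: hecke_module_induct)
    case (add y c w)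
    have "mul x (basis_T w) = mul' x (basis_T w)" using add(2)
    proof (induction w rule: weyl_induct)
      case (step w j)
      have s: "basis_T (sgen j) \<in> hecke_module m" "basis_T w \<in> hecke_module m"
        using step by simp_all
      have "basis_T (sgen j \<circ> w) = rmul q j (basis_T w)" using step by (simp add: rmul_T)
      then have "mul (basis_T w) (basis_T (sgen j)) = basis_T (sgen j \<circ> w)"
          "mul' (basis_T w) (basis_T (sgen j)) = basis_T (sgen j \<circ> w)"
        using step by (simp_all add: A.mul_sgen B.mul_sgen)
      then show ?case
        using step(2,4) A.assoc[OF x s(2,1)] B.assoc[OF x s(2,1)]
          A.mul_sgen[OF A.closed[OF x s(2)]] B.mul_sgen[OF B.closed[OF x s(2)]] by (simp del: o_apply id_apply)
    qed (simp add: A.one_right B.one_right x del: o_apply id_apply)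
    then show ?case
      using add x by (simp add: A.add_right B.add_right A.scale_right B.scale_right)
  qed (simp add: A.zero_right B.zero_right x)
qed

end

theory Submission
  imports Defs
begin

text \<open>Since \<open>T\<^bsub>a(j,l+1)\<^esub> = T\<^bsub>a(j,l)\<^esub> T\<^bsub>s\<^esub>\<close> with \<open>s = s\<^sub>j\<^sub>-\<^sub>l\<close>, the formula follows by
  induction on \<open>l\<close> once it is known for \<open>l = 1\<close>, that is, for right multiplication by a single
  \<open>T\<^bsub>s\<^esub>\<close>, \<open>s = s\<^sub>i\<close>.  There the terms \<open>k = m - i\<close> and \<open>k = m - i + 1\<close> are mixed, because
  \<open>a(m, m-i+1) = a(m, m-i) s\<^sub>i\<close>.  In all other terms the permutation \<open>a(m,k)\<close> carries a pair
  \<open>(r, r+1)\<close> to \<open>(i, i+1)\<close>, so that \<open>T\<^bsub>s\<^esub>\<close> moves to the left of \<open>T\<^bsub>a(m,k)\<^esub>\<close> and becomes the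
  basis element of \<open>s\<^sub>r\<close>; here \<open>r = i\<close> for \<open>k < m - i\<close> and \<open>r = i - 1\<close> for \<open>k > m - i + 1\<close>.\<close>

section \<open>The cycles \<open>a_elem j k\<close>\<close>

lemma a_elem_0 [simp]: "a_elem j 0 = id"
  by (simp add: a_elem_def)

lemma a_elem_Suc:
  assumes "k \<le> j" shows "a_elem j (Suc k) = sgen (j - k) \<circ> a_elem j k"
proof -
  have "[j - k..<j + 1] = (j - k) # [j + 1 - k..<j + 1]"
    using assms by (subst upt_conv_Cons) (auto simp: Suc_diff_le)
  then show ?thesis by (simp add: a_elem_def del: o_apply upt_Suc)
qed

text \<open>The new factor \<open>sgen (j - k)\<close> acts last: it lowers the image
  \<open>j + 1 - k\<close> of \<open>j + 1\<close> by one and raises the image of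
  \<open>j - k\<close>, a fixed point so far, by one.\<close>

lemma a_elem_apply:
  "k \<le> j \<Longrightarrow> a_elem j k x =
    (if x = j + 1 then j + 1 - k else if j + 1 - k \<le> x \<and> x \<le> j then x + 1 else x)"
proof (induction k)
  case (Suc k)
  then obtain d where "j = Suc k + d" using le_Suc_ex by blast
  then show ?case using Suc.IH by (auto simp: a_elem_Suc sgen_app)
qed auto

lemma a_elem_weyl [simp]: "j \<le> m \<Longrightarrow> k \<le> j \<Longrightarrow> a_elem j k \<in> weyl m"
  unfolding a_elem_def by (rule word_perm_weyl) auto

lemma up_iff_values:
  assumes "bij w" "w x = j" "w y = j + 1"
  shows "up j w \<longleftrightarrow> x < y"
  using assms unfolding up_def by (metis bij_inv_eq_iff)

text \<open>The point \<open>j - k\<close> is still fixed, while \<open>j - k + 1\<close> is the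
  image of the larger point \<open>j + 1\<close>. For \<open>k < j\<close>, appending the next
  generator therefore increases the length.\<close>

lemma up_a_elem:
  assumes "k \<le> j" shows "up (j - k) (a_elem j k)"
proof -
  have "bij (a_elem j k)" using assms by (intro weyl_bij[of _ j]) simp
  then show ?thesis
    using up_iff_values[of "a_elem j k" "j - k" "j - k" "j + 1"] assms
    by (simp add: a_elem_apply Suc_diff_le)
qed

lemma hecke_module_mono: "m \<le> n \<Longrightarrow> hecke_module m \<subseteq> hecke_module n"
proof -
  assume "m \<le> n"
  then have "weyl m \<subseteq> weyl n" by (auto simp: weyl_def intro: permutes_subset)
  then show ?thesis by (auto simp: hecke_module_def)
qed

section \<open>Coefficient lists and a single generator\<close>

lemma nested_cong:
  "(\<And>k. k \<le> m \<Longrightarrow> h k = h' k) \<Longrightarrow> nested m mul h = nested m mul h'"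
  by (simp add: nested_def)

text \<open>This is the case \<open>j = i\<close>, \<open>l = 1\<close> of the formula. With
  \<open>rmul\<close> in place of the product, the entries stay in
  \<open>hecke_module (m - 1)\<close> by \<open>rmul_closed\<close>; the axiom \<open>closed\<close>
  speaks of \<open>hecke_module m\<close> only.\<close>

definition nested_sgen :: "nat \<Rightarrow> 'z \<Rightarrow> nat \<Rightarrow> (nat \<Rightarrow> (perm \<Rightarrow>\<^sub>0 'z::{comm_ring,comm_monoid_mult}))
    \<Rightarrow> nat \<Rightarrow> (perm \<Rightarrow>\<^sub>0 'z)"
  where "nested_sgen m q i h k =
    (if k < m - i then rmul q i (h k)
     else if k = m - i then scale q (h (k + 1))
     else if k = m - i + 1 then h (m - i) + scale (q - 1) (h k)
     else rmul q (i - 1) (h k))"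

text \<open>The first range forces \<open>i < m\<close> and the last one \<open>i \<ge> 2\<close>,
  so \<open>rmul\<close> occurs with indices in \<open>{1..m - 1}\<close> only.\<close>

lemma nested_sgen_closed:
  assumes h: "\<And>k. k \<le> m \<Longrightarrow> h k \<in> hecke_module (m - 1)" and "i \<in> {1..m}" "k \<le> m"
  shows "nested_sgen m q i h k \<in> hecke_module (m - 1)"
proof -
  consider "k < m - i" | "k = m - i" | "k = m - i + 1" | "k > m - i + 1" by linarith
  then show ?thesis
    by cases (use assms in \<open>auto simp: nested_sgen_def intro!: h rmul_closed hecke_module_add hecke_module_scale\<close>)
qed

section \<open>Products of basis elements with generators\<close>

context hecke_algebra
begin

text \<open>The axioms describe right multiplication by generators. For the left one,
  \<open>w\<close> is built up by factors on the right, and associativity together with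
  \<open>lmul_rmul\<close> carries the claim past each of them.\<close>

lemma sgen_mul:
  assumes i: "i \<in> {1..m}" and x: "x \<in> hecke_module m"
  shows "basis_T (sgen i) \<cdot> x = lmul q i x"
  using x
proof (induction rule: hecke_module_induct)
  case zero
  show ?case using i by (simp add: zero_right)
next
  case (add x c w)
  have "basis_T (sgen i) \<cdot> basis_T w = lmul q i (basis_T w)" using add(2)
  proof (induction w rule: weyl_induct)
    case id
    show ?case using i by (simp add: one_right lmul_T del: id_apply o_apply) simp
  next
    case (step w j)
    have T: "basis_T (sgen j \<circ> w) = rmul q j (basis_T w)" using step by (simp add: rmul_T)
    also have "\<dots> = basis_T w \<cdot> basis_T (sgen j)" using step by (simp add: mul_sgen)
    finally have "basis_T (sgen i) \<cdot> basis_T (sgen j \<circ> w)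
        = (basis_T (sgen i) \<cdot> basis_T w) \<cdot> basis_T (sgen j)"
      using assoc[of "basis_T (sgen i)" "basis_T w" "basis_T (sgen j)"] step(1,2) i by simp
    also have "\<dots> = rmul q j (lmul q i (basis_T w))"
      using step i by (simp add: mul_sgen lmul_closed)
    finally show ?case using T step by (simp add: lmul_rmul[of _ m] del: o_apply)
  qed
  then show ?case using add i by (simp add: add_right scale_right)
qed

text \<open>The hypotheses give \<open>sgen i \<circ> w = w \<circ> sgen r\<close>, and both
  products increase the length, so both are the basis element of this permutation.\<close>

lemma T_mul_sgen_swap:
  assumes w: "w \<in> weyl m" and i: "i \<in> {1..m}" and r: "r \<in> {1..m}"
    and wr: "w r = i" "w (r + 1) = i + 1"
  shows "basis_T w \<cdot> basis_T (sgen i) = basis_T (sgen r) \<cdot> basis_T w"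
proof -
  have b: "bij w" using w by (rule weyl_bij)
  have "sgen i (w x) = w (sgen r x)" for x
    using wr inj_eq[OF bij_is_inj[OF b], of x r] inj_eq[OF bij_is_inj[OF b], of x "r + 1"]
    by (auto simp: sgen_app)
  then have "sgen i \<circ> w = w \<circ> sgen r" by auto
  moreover have "up i w" using up_iff_values[OF b wr] by simp
  ultimately show ?thesis using w i r wr by (simp add: mul_sgen sgen_mul rmul_T lmul_T del: o_apply)
qed

lemma a_elem_mul_sgen:
  assumes "j \<le> m" "k < j"
  shows "basis_T (a_elem j k) \<cdot> basis_T (sgen (j - k)) = basis_T (a_elem j (Suc k))"
proof -
  have "j - k \<in> {1..m}" using assms by auto
  from mul_sgen[OF _ this] show ?thesis
    using assms up_a_elem[of k j] by (simp add: rmul_T a_elem_Suc del: o_apply)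
qed

lemma a_elem_Suc_mul_sgen:
  assumes "j \<le> m" "k < j"
  shows "basis_T (a_elem j (Suc k)) \<cdot> basis_T (sgen (j - k))
    = scale (q - 1) (basis_T (a_elem j (Suc k))) + scale q (basis_T (a_elem j k))"
proof -
  have b: "bij (a_elem j k)" using assms by (intro weyl_bij[of _ j]) simp
  have "sgen (j - k) \<circ> a_elem j (Suc k) = a_elem j k"
    using assms by (simp add: a_elem_Suc fun_eq_iff)
  moreover have "\<not> up (j - k) (a_elem j (Suc k))"
    using assms up_sgen[OF b] up_a_elem[of k j] by (simp add: a_elem_Suc del: o_apply)
  moreover have "j - k \<in> {1..m}" using assms by auto
  note mul_sgen[OF _ this]
  ultimately show ?thesis using assms by (simp add: rmul_T del: o_apply)
qed

text \<open>This brings products with \<open>basis_T (a_elem j k)\<close> into the form in which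
  \<open>nested_sgen\<close> acts. It is applied both to \<open>j\<close> and to
  \<open>j - 1\<close>.\<close>

lemma mul_a_elem_Suc:
  assumes "x \<in> hecke_module m" "j \<le> m" "k < j"
  shows "x \<cdot> basis_T (a_elem j (Suc k)) = rmul q (j - k) (x \<cdot> basis_T (a_elem j k))"
proof -
  have "x \<cdot> basis_T (a_elem j (Suc k)) = (x \<cdot> basis_T (a_elem j k)) \<cdot> basis_T (sgen (j - k))"
    using assms by (simp add: assoc flip: a_elem_mul_sgen)
  moreover have "j - k \<in> {1..m}" using assms by auto
  ultimately show ?thesis using assms mul_sgen[OF closed] by simp
qed

section \<open>The effect on coefficient lists\<close>

lemma sum_mul:
  assumes "\<And>k. k \<in> A \<Longrightarrow> f k \<in> hecke_module m" and "y \<in> hecke_module m"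
  shows "sum f A \<cdot> y = (\<Sum>k\<in>A. f k \<cdot> y)"
  using assms(1)
  by (induction A rule: infinite_finite_induct)
    (use assms(2) in \<open>simp_all add: zero_left add_left hecke_module_sum\<close>)

lemma nested_mul_sgen:
  assumes h: "\<And>k. k \<le> m \<Longrightarrow> h k \<in> hecke_module (m - 1)" and i: "i \<in> {1..m}"
  shows "nested m (\<cdot>) h \<cdot> basis_T (sgen i) = nested m (\<cdot>) (nested_sgen m q i h)"
proof -
  let ?a = "\<lambda>k. basis_T (a_elem m k)" and ?t = "\<lambda>i. basis_T (sgen i)"
  let ?g = "nested_sgen m q i h" and ?P = "{m - i, m - i + 1}"
  have hm: "h k \<in> hecke_module m" if "k \<le> m" for k
    using h[OF that] hecke_module_mono[of "m - 1" m] by auto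
  have swap: "h k \<cdot> (?a k \<cdot> ?t i) = rmul q r (h k) \<cdot> ?a k"
    if "k \<le> m" "r \<in> {1..m}" "a_elem m k r = i" "a_elem m k (r + 1) = i + 1" for k r
  proof -
    have "?a k \<cdot> ?t i = ?t r \<cdot> ?a k" using T_mul_sgen_swap[OF _ i that(2-4)] that(1) by simp
    then show ?thesis
      using assoc[of "h k" "?t r" "?a k"] mul_sgen[OF hm that(2), of k] that(1,2) hm[of k] by simp
  qed
  have "nested m (\<cdot>) h \<cdot> ?t i = (\<Sum>k = 0..m. h k \<cdot> (?a k \<cdot> ?t i))"
    unfolding nested_def using i hm
    by (subst sum_mul) (auto intro!: closed assoc sum.cong)
  also have "\<dots> = (\<Sum>k \<in> {0..m} - ?P. h k \<cdot> (?a k \<cdot> ?t i)) + (\<Sum>k \<in> ?P. h k \<cdot> (?a k \<cdot> ?t i))"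
    using i by (intro sum.subset_diff) auto
  also have "(\<Sum>k \<in> {0..m} - ?P. h k \<cdot> (?a k \<cdot> ?t i)) = (\<Sum>k \<in> {0..m} - ?P. ?g k \<cdot> ?a k)"
  proof (rule sum.cong)
    fix k assume k: "k \<in> {0..m} - ?P"
    then have "k \<noteq> m - i" "k \<noteq> m - i + 1" by auto
    then consider "k < m - i" | "k > m - i + 1" by linarith
    then show "h k \<cdot> (?a k \<cdot> ?t i) = ?g k \<cdot> ?a k"
    proof cases
      case 1
      \<comment> \<open>Both points lie below \<open>m + 1 - k\<close>, hence outside the
        cycle.\<close>
      then have "a_elem m k i = i" "a_elem m k (i + 1) = i + 1" by (auto simp: a_elem_apply)
      with 1 show ?thesis using swap[of k i] k i by (simp add: nested_sgen_def)
    next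
      case 2
      \<comment> \<open>From \<open>m - i + 1 < k\<close> and \<open>k \<le> m\<close> follows
        \<open>i \<ge> 2\<close>. The points \<open>i - 1\<close> and \<open>i\<close> lie between
        \<open>m + 1 - k\<close> and \<open>m\<close>, where the cycle shifts by one.\<close>
      then have r: "i - 1 \<in> {1..m}" using k i by auto
      have "a_elem m k (i - 1) = i" "a_elem m k (i - 1 + 1) = i + 1"
        using 2 r k i by (auto simp: a_elem_apply)
      with 2 show ?thesis using swap[OF _ r, of k] k by (simp add: nested_sgen_def)
    qed
  qed simp
  \<comment> \<open>Here the summands need not match one by one: the two products are expanded and
    regrouped by \<open>?a (m - i)\<close> and \<open>?a (m - i + 1)\<close>.\<close>
  also have "(\<Sum>k \<in> ?P. h k \<cdot> (?a k \<cdot> ?t i)) = (\<Sum>k \<in> ?P. ?g k \<cdot> ?a k)"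
  proof -
    have a: "?a (m - i) \<in> hecke_module m" "?a (m - i + 1) \<in> hecke_module m"
      and h: "h (m - i) \<in> hecke_module m" "h (m - i + 1) \<in> hecke_module m"
      using i by (auto intro!: hm)
    have "h (m - i) \<cdot> (?a (m - i) \<cdot> ?t i) = h (m - i) \<cdot> ?a (m - i + 1)"
      using a_elem_mul_sgen[of m "m - i"] i by simp
    moreover have "h (m - i + 1) \<cdot> (?a (m - i + 1) \<cdot> ?t i)
        = scale (q - 1) (h (m - i + 1) \<cdot> ?a (m - i + 1)) + scale q (h (m - i + 1) \<cdot> ?a (m - i))"
    proof -
      have "?a (m - i + 1) \<cdot> ?t i = scale (q - 1) (?a (m - i + 1)) + scale q (?a (m - i))"
        using a_elem_Suc_mul_sgen[of m "m - i"] i by simp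
      then show ?thesis by (simp only: add_right scale_right a h hecke_module_scale)
    qed
    moreover have "?g (m - i) \<cdot> ?a (m - i) = scale q (h (m - i + 1) \<cdot> ?a (m - i))"
      "?g (m - i + 1) \<cdot> ?a (m - i + 1)
        = h (m - i) \<cdot> ?a (m - i + 1) + scale (q - 1) (h (m - i + 1) \<cdot> ?a (m - i + 1))"
      using add_left[OF h(1) hecke_module_scale[OF h(2)] a(2)] scale_left[OF h(2)] a
      by (simp_all add: nested_sgen_def)
    ultimately show ?thesis by simp
  qed
  also have "(\<Sum>k \<in> {0..m} - ?P. ?g k \<cdot> ?a k) + (\<Sum>k \<in> ?P. ?g k \<cdot> ?a k) = nested m (\<cdot>) ?g"
    unfolding nested_def using i by (intro sum.subset_diff[symmetric]) auto
  finally show ?thesis .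
qed

text \<open>The four cases of the formula as one function, so that the lists for \<open>l\<close>
  and \<open>Suc l\<close> can be compared. The truncated \<open>l - 1\<close> does no harm, since
  the second range is empty for \<open>l = 0\<close>.\<close>

definition nested_a_elem :: "nat \<Rightarrow> nat \<Rightarrow> (nat \<Rightarrow> (perm \<Rightarrow>\<^sub>0 'z)) \<Rightarrow> nat \<Rightarrow> (perm \<Rightarrow>\<^sub>0 'z)"
  where "nested_a_elem j l h k =
    (if k < m - j then h k \<cdot> basis_T (a_elem j l)
     else if k < m - j + l then scale q (h (k + 1) \<cdot> basis_T (a_elem (j - 1) (l - 1)))
     else if k = m - j + l then h (m - j) +
       scale (q - 1) (\<Sum>i = 1..l. h (m - j + i) \<cdot> basis_T (a_elem (j - 1) (i - 1)))
     else h k \<cdot> basis_T (a_elem (j - 1) l))"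

text \<open>As \<open>m - (j - l) = m - j + l\<close>, the generator mixes the entry that carries
  the sum with the next one. The sum moves up one place and gains the summand for
  \<open>Suc l\<close>; the place it leaves receives \<open>q\<close> times the next entry.\<close>

lemma nested_sgen_a_elem:
  assumes h: "\<And>k. k \<le> m \<Longrightarrow> h k \<in> hecke_module m" and "j \<le> m" "l < j" "k \<le> m"
  shows "nested_sgen m q (j - l) (nested_a_elem j l h) k = nested_a_elem j (Suc l) h k"
proof -
  have i: "m - (j - l) = m - j + l" using assms by simp
  consider "k < m - j" | "m - j \<le> k" "k < m - j + l" | "k = m - j + l" | "k = m - j + l + 1"
    | "k > m - j + l + 1" by linarith
  then show ?thesis
  proof cases
    case 1
    then have "k < m - (j - l)" by linarith
    then show ?thesis
      unfolding nested_sgen_def nested_a_elem_def using 1 assms mul_a_elem_Suc by simp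
  next
    case 2
    then obtain l' where l': "l = Suc l'" by (cases l) auto
    \<comment> \<open>Since \<open>j - l = (j - 1) - (l - 1)\<close>, the generator that extends
      \<open>a_elem j l\<close> also extends \<open>a_elem (j - 1) (l - 1)\<close>.\<close>
    then have "h (k + 1) \<cdot> basis_T (a_elem (j - 1) l)
        = rmul q (j - l) (h (k + 1) \<cdot> basis_T (a_elem (j - 1) l'))"
      using mul_a_elem_Suc[of "h (k + 1)" "j - 1" l'] 2 assms by simp
    then show ?thesis
      using 2 l' i by (simp add: nested_sgen_def nested_a_elem_def)
  next
    case 3
    then show ?thesis using i by (simp add: nested_sgen_def nested_a_elem_def)
  next
    case 4
    then show ?thesis using i
      by (simp add: nested_sgen_def nested_a_elem_def scale_simps add.assoc)
  next
    case 5
    \<comment> \<open>Beyond the mixed entries the index drops to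
      \<open>j - l - 1 = (j - 1) - l\<close>, the next factor of
      \<open>a_elem (j - 1) l\<close>.\<close>
    then have "h k \<cdot> basis_T (a_elem (j - 1) (Suc l))
        = rmul q (j - l - 1) (h k \<cdot> basis_T (a_elem (j - 1) l))"
      using mul_a_elem_Suc[of "h k" "j - 1" l] assms by (simp add: diff_right_commute)
    then show ?thesis using 5 i by (simp add: nested_sgen_def nested_a_elem_def)
  qed
qed

text \<open>Both claims go through one induction: to multiply the list for \<open>l\<close> by a
  further generator, its entries must be known to lie in
  \<open>hecke_module (m - 1)\<close>.\<close>

lemma nested_mul_a_elem:
  assumes h: "\<And>k. k \<le> m \<Longrightarrow> h k \<in> hecke_module (m - 1)" and j: "1 \<le> j" "j \<le> m"
    and "l \<le> j"
  shows "(\<forall>k\<le>m. nested_a_elem j l h k \<in> hecke_module (m - 1)) \<and>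
    nested m (\<cdot>) h \<cdot> basis_T (a_elem j l) = nested m (\<cdot>) (nested_a_elem j l h)"
proof -
  have hm: "h k \<in> hecke_module m" if "k \<le> m" for k
    using h[OF that] hecke_module_mono[of "m - 1" m] by auto
  have n: "nested m (\<cdot>) h \<in> hecke_module m"
    unfolding nested_def by (rule hecke_module_sum) (simp add: closed hm)
  show ?thesis using \<open>l \<le> j\<close>
  proof (induction l)
    case 0
    \<comment> \<open>For \<open>l = 0\<close> the second range and the sum are empty, and the
      remaining factors are \<open>basis_T id\<close>.\<close>
    have "nested_a_elem j 0 h k = h k" if "k \<le> m" for k
      using that hm[OF that]
      by (simp add: nested_a_elem_def one_right scale_simps del: id_apply)
    then show ?case using h one_right[OF n] nested_cong[of m "nested_a_elem j 0 h" h]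
      by (simp del: id_apply)
  next
    case (Suc l)
    let ?g = "nested_a_elem j l h"
    have g: "?g k \<in> hecke_module (m - 1)" if "k \<le> m" for k using Suc that by simp
    have i: "j - l \<in> {1..m}" using Suc j by auto
    have step: "nested_sgen m q (j - l) ?g k = nested_a_elem j (Suc l) h k" if "k \<le> m" for k
      using nested_sgen_a_elem[OF hm] that Suc.prems j by simp
    have "nested m (\<cdot>) h \<cdot> basis_T (a_elem j (Suc l)) = nested m (\<cdot>) ?g \<cdot> basis_T (sgen (j - l))"
    proof -
      have "basis_T (a_elem j (Suc l)) = basis_T (a_elem j l) \<cdot> basis_T (sgen (j - l))"
        using a_elem_mul_sgen Suc.prems j by simp
      moreover have "basis_T (a_elem j l) \<in> hecke_module m"
        "basis_T (sgen (j - l)) \<in> hecke_module m"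
        using Suc.prems j i by auto
      ultimately show ?thesis using assoc[OF n] Suc by (metis Suc_leD)
    qed
    also have "\<dots> = nested m (\<cdot>) (nested_a_elem j (Suc l) h)"
      using nested_mul_sgen[of ?g, OF g i] nested_cong[OF step] by simp
    finally show ?case using nested_sgen_closed[of m ?g, OF g i, where q = q] step by simp
  qed
qed

end

theorem proposition3p2:
  fixes m j l :: nat
    and q :: "'z::{comm_ring,comm_monoid_mult}"
    and mul :: "(perm \<Rightarrow>\<^sub>0 'z) \<Rightarrow> (perm \<Rightarrow>\<^sub>0 'z) \<Rightarrow> (perm \<Rightarrow>\<^sub>0 'z)" (infixl "\<cdot>" 70)
    and h h' :: "nat \<Rightarrow> (perm \<Rightarrow>\<^sub>0 'z)"
  assumes "m \<ge> 1"
    and "hecke_algebra m q (\<cdot>)"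
    and "\<And>k. k \<le> m \<Longrightarrow> h k \<in> hecke_module (m - 1)"
    and "1 \<le> j" and "j \<le> m" and "l \<le> j"
    and a: "\<And>k. \<lbrakk>k \<le> m; k < m - j\<rbrakk> \<Longrightarrow> h' k = h k \<cdot> basis_T (a_elem j l)"
    and b: "\<And>k. \<lbrakk>k \<le> m; m - j \<le> k; k < m - j + l\<rbrakk> \<Longrightarrow>
      h' k = scale q (h (k + 1) \<cdot> basis_T (a_elem (j - 1) (l - 1)))"
    and c: "\<And>k. \<lbrakk>k \<le> m; k = m - j + l\<rbrakk> \<Longrightarrow>
      h' k = h (m - j) +
        scale (q - 1) (\<Sum>i = 1..l. h (m - j + i) \<cdot> basis_T (a_elem (j - 1) (i - 1)))"
    and d: "\<And>k. \<lbrakk>k \<le> m; k > m - j + l\<rbrakk> \<Longrightarrow> h' k = h k \<cdot> basis_T (a_elem (j - 1) l)"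
  shows "(\<forall>k\<le>m. h' k \<in> hecke_module (m - 1)) \<and>
    nested m (\<cdot>) h \<cdot> basis_T (a_elem j l) = nested m (\<cdot>) h'"
proof -
  interpret hecke_algebra m q mul by fact
  have "h' k = nested_a_elem j l h k" if "k \<le> m" for k
  proof -
    consider "k < m - j" | "m - j \<le> k" "k < m - j + l" | "k = m - j + l" | "k > m - j + l"
      by linarith
    then show ?thesis
      by cases (use that a b c d in \<open>simp_all add: nested_a_elem_def\<close>)
  qed
  then show ?thesis
    using nested_mul_a_elem[of h j l] assms(3-6) nested_cong[of m h' "nested_a_elem j l h" mul]
    by simp
qed

end
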